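(* Let $Y$ be a convergence space. The following are equivalent: (1) $Y$ is regular; (2) for every convergence space $X$, every $f\in Y^{X}$ and every $\mathcal{F}\in\mathbb{F}(Y^{X})$, if $f\in\lim_{[X,Y]}\mathcal{F}$ then $f\in C(X,Y)$; (3) for every topological space $X$, every $f\in Y^{X}$ and every $\mathcal{F}\in\mathbb{F}(Y^{X})$, if $f\in\lim_{[X,Y]}\mathcal{F}$ then $f\in C(X,Y)$.
   Context: Filters are proper. $\mathbb{F}X$ is the set of filters on $X$, ordered by inclusion; $\mathbb{U}X$ is the set of ultrafilters; $\mathcal{F}\wedge\mathcal{G}=\mathcal{F}\cap\mathcal{G}$; $\{x\}^{\uparrow}$ is the principal ultrafilter at $x$; $\mathcal{A}^{\uparrow}=\{B\subseteq X:\exists A\in\mathcal{A},\ A\subseteq B\}$. A filter base is identified with the filter it generates. $f[\mathcal{F}]=\{f(F):F\in\mathcal{F}\}^{\uparrow}$. A convergence space is a set $X$ with a relation between filters and points, written $x\in\lim_X\mathcal{F}$, such that: $\mathcal{F}\le\mathcal{G}$ implies $\lim\mathcal{F}\subseteq\lim\mathcal{G}$; $\lim(\mathcal{F}\wedge\mathcal{G})\supseteq\lim\mathcal{F}\cap\lim\mathcal{G}$; and $x\in\lim\{x\}^{\uparrow}$ for all $x\in X$. A topological space is viewed as a convergence space: $x\in\lim\mathcal{F}$ iff $\mathcal{F}$ contains the neighborhood filter of $x$. A map $f:X\to Y$ between convergence spaces is continuous if $f(\lim_X\mathcal{F})\subseteq\lim_Y f[\mathcal{F}]$ for all $\mathcal{F}\in\mathbb{F}X$;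 $C(X,Y)$ is the set of continuous maps and $Y^{X}$ the set of all maps. For $A\subseteq X$, $\mathrm{adh}\,A=\bigcup\{\lim\mathcal{U}:\mathcal{U}\in\mathbb{U}X,\ A\in\mathcal{U}\}$, and $\mathrm{adh}^{\natural}\mathcal{F}=\{\mathrm{adh}\,F:F\in\mathcal{F}\}$. A convergence space is regular if $\lim\mathcal{F}\subseteq\lim(\mathrm{adh}^{\natural}\mathcal{F})$ for every filter $\mathcal{F}$. $\lim_{[X,Y]}$ denotes continuous convergence, considered on all of $Y^{X}$: for $f\in Y^{X}$ and $\mathcal{F}\in\mathbb{F}(Y^{X})$, $f\in\lim_{[X,Y]}\mathcal{F}$ iff for every $\mathcal{G}\in\mathbb{F}X$ and every $x\in\lim_X\mathcal{G}$, $f(x)\in\lim_Y\langle\mathcal{G},\mathcal{F}\rangle$, where $\langle\mathcal{G},\mathcal{F}\rangle=\{\langle G,F\rangle:G\in\mathcal{G},F\in\mathcal{F}\}^{\uparrow}$ and $\langle G,F\rangle=\{h(x):h\in F,x\in G\}$. *)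

theory Defs
  imports "HOL-Analysis.Analysis"
begin

text \<open>
  Filters on a set \<open>X\<close> are library filters that are proper and live on \<open>X\<close>; a set \<open>A\<close> belongs to
  \<open>F\<close> iff \<open>\<forall>\<^sub>F x in F. x \<in> A\<close>. The library orders filters by reverse inclusion: \<open>G \<le> F\<close> says that
  every set of \<open>F\<close> is a set of \<open>G\<close>, so the intersection of two filters (as families of sets) is
  \<open>sup\<close>, \<open>bot\<close> is the improper filter, and \<open>principal {x}\<close> is the principal ultrafilter at \<open>x\<close>.
\<close>

definition proper_filter_on :: "'a set \<Rightarrow> 'a filter \<Rightarrow> bool" where
  "proper_filter_on X F \<longleftrightarrow> F \<noteq> bot \<and> F \<le> principal X"

definition ultrafilter_on :: "'a set \<Rightarrow> 'a filter \<Rightarrow> bool" where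
  "ultrafilter_on X U \<longleftrightarrow>
     proper_filter_on X U \<and> (\<forall>G. proper_filter_on X G \<longrightarrow> G \<le> U \<longrightarrow> G = U)"

text \<open>
  A convergence structure on \<open>X\<close> is given by the function sending a filter to its set of limits.
  Its values at library filters that are not proper filters on \<open>X\<close> are irrelevant.
\<close>

locale convergence_space =
  fixes X :: "'a set" and limX :: "'a filter \<Rightarrow> 'a set"
  assumes lim_subset: "proper_filter_on X F \<Longrightarrow> limX F \<subseteq> X"
    and lim_mono: "proper_filter_on X F \<Longrightarrow> proper_filter_on X G \<Longrightarrow> G \<le> F \<Longrightarrow> limX F \<subseteq> limX G"
    and lim_sup: "proper_filter_on X F \<Longrightarrow> proper_filter_on X G \<Longrightarrow>
      limX F \<inter> limX G \<subseteq> limX (sup F G)"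
    and lim_point: "x \<in> X \<Longrightarrow> x \<in> limX (principal {x})"

definition topological_lim :: "'a topology \<Rightarrow> 'a filter \<Rightarrow> 'a set" where
  "topological_lim T F = {x \<in> topspace T. F \<le> nhdsin T x}"

lemma convergence_space_topological: "convergence_space (topspace T) (topological_lim T)"
proof
  fix x assume "x \<in> topspace T"
  then show "x \<in> topological_lim T (principal {x})"
    by (auto simp: topological_lim_def le_filter_def eventually_nhdsin eventually_principal)
qed (auto simp: topological_lim_def)

definition adh :: "'a set \<Rightarrow> ('a filter \<Rightarrow> 'a set) \<Rightarrow> 'a set \<Rightarrow> 'a set" where
  "adh X limX A = \<Union> {limX U |U. ultrafilter_on X U \<and> (\<forall>\<^sub>F x in U. x \<in> A)}"

definition adh_filter :: "'a set \<Rightarrow> ('a filter \<Rightarrow> 'a set) \<Rightarrow> 'a filter \<Rightarrow> 'a filter" where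
  "adh_filter X limX F = (INF A\<in>{A. A \<subseteq> X \<and> (\<forall>\<^sub>F x in F. x \<in> A)}. principal (adh X limX A))"

lemma adh_mono: "A \<subseteq> B \<Longrightarrow> adh X limX A \<subseteq> adh X limX B"
  unfolding adh_def by (blast intro: eventually_mono)

lemma eventually_adh_filter:
  assumes "F \<le> principal X"
  shows "(\<forall>\<^sub>F x in adh_filter X limX F. x \<in> B) \<longleftrightarrow>
    (\<exists>A\<subseteq>X. (\<forall>\<^sub>F x in F. x \<in> A) \<and> adh X limX A \<subseteq> B)"
proof -
  let ?S = "{A. A \<subseteq> X \<and> (\<forall>\<^sub>F x in F. x \<in> A)}"
  have "X \<in> ?S" using assms by (simp add: le_principal)
  moreover have "\<exists>C\<in>?S. principal (adh X limX C) \<le> inf (principal (adh X limX A)) (principal (adh X limX B))"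
    if "A \<in> ?S" "B \<in> ?S" for A B
    using that by (intro bexI[of _ "A \<inter> B"]) (auto simp: eventually_conj intro: adh_mono[THEN subsetD, rotated])
  ultimately show ?thesis
    unfolding adh_filter_def
    by (subst eventually_INF_base) (auto simp: eventually_principal)
qed

definition regular_convergence :: "'a set \<Rightarrow> ('a filter \<Rightarrow> 'a set) \<Rightarrow> bool" where
  "regular_convergence X limX \<longleftrightarrow>
     (\<forall>F. proper_filter_on X F \<longrightarrow> limX F \<subseteq> limX (adh_filter X limX F))"

text \<open>
  The set of all maps from \<open>X\<close> to \<open>Y\<close> is \<open>X \<rightarrow>\<^sub>E Y\<close>: maps with value \<open>undefined\<close> outside \<open>X\<close>.
\<close>

definition continuous_maps ::
  "'x set \<Rightarrow> ('x filter \<Rightarrow> 'x set) \<Rightarrow> 'y set \<Rightarrow> ('y filter \<Rightarrow> 'y set) \<Rightarrow> ('x \<Rightarrow> 'y) set" where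
  "continuous_maps X limX Y limY =
     {f \<in> X \<rightarrow>\<^sub>E Y. \<forall>F. proper_filter_on X F \<longrightarrow> f ` limX F \<subseteq> limY (filtermap f F)}"

definition eval_filter :: "'x filter \<Rightarrow> ('x \<Rightarrow> 'y) filter \<Rightarrow> 'y filter" where
  "eval_filter G F = filtermap (\<lambda>(x, h). h x) (G \<times>\<^sub>F F)"

lemma eventually_eval_filter:
  "(\<forall>\<^sub>F y in eval_filter G F. y \<in> B) \<longleftrightarrow>
    (\<exists>A H. (\<forall>\<^sub>F x in G. x \<in> A) \<and> (\<forall>\<^sub>F h in F. h \<in> H) \<and> {h x |h x. h \<in> H \<and> x \<in> A} \<subseteq> B)"
proof
  assume "\<forall>\<^sub>F y in eval_filter G F. y \<in> B"
  then obtain P Q where "eventually P G" "eventually Q F" "\<forall>x h. P x \<longrightarrow> Q h \<longrightarrow> h x \<in> B"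
    by (auto simp: eval_filter_def eventually_filtermap eventually_prod_filter)
  then show "\<exists>A H. (\<forall>\<^sub>F x in G. x \<in> A) \<and> (\<forall>\<^sub>F h in F. h \<in> H) \<and> {h x |h x. h \<in> H \<and> x \<in> A} \<subseteq> B"
    by (intro exI[of _ "Collect P"] exI[of _ "Collect Q"]) auto
next
  assume "\<exists>A H. (\<forall>\<^sub>F x in G. x \<in> A) \<and> (\<forall>\<^sub>F h in F. h \<in> H) \<and> {h x |h x. h \<in> H \<and> x \<in> A} \<subseteq> B"
  then show "\<forall>\<^sub>F y in eval_filter G F. y \<in> B"
    unfolding eval_filter_def eventually_filtermap eventually_prod_filter by fast
qed

definition continuous_convergence_lim ::
  "'x set \<Rightarrow> ('x filter \<Rightarrow> 'x set) \<Rightarrow> 'y set \<Rightarrow> ('y filter \<Rightarrow> 'y set) \<Rightarrow>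
    ('x \<Rightarrow> 'y) filter \<Rightarrow> ('x \<Rightarrow> 'y) set" where
  "continuous_convergence_lim X limX Y limY F =
     {f \<in> X \<rightarrow>\<^sub>E Y. \<forall>G. proper_filter_on X G \<longrightarrow> (\<forall>x\<in>limX G. f x \<in> limY (eval_filter G F))}"

end

theory Submission
  imports Defs
begin

text \<open>
  If \<open>F\<close> converges continuously to \<open>f\<close>, convergence along the principal ultrafilter at \<open>a\<close> already
  puts \<open>f a\<close> in the adherence of the set of values \<open>h a\<close>, \<open>h \<in> H\<close>, for every \<open>H\<close> in \<open>F\<close>. Hence
  \<open>f\<close> maps a set \<open>A\<close> into the adherence of \<open>\<langle>A, H\<rangle>\<close>, so \<open>f[G]\<close> is finer than \<open>adh\<^sup>\<natural>\<langle>G, F\<rangle>\<close>, and regularity of the codomain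
  transfers the convergence of \<open>\<langle>G, F\<rangle>\<close> to \<open>f[G]\<close>. This gives continuity of \<open>f\<close>
  (\<open>continuous_convergence_lim_continuous\<close>).

  Conversely, let \<open>G\<close> converge to \<open>y0\<close> in \<open>Y\<close>. The test space is a topological fan: one
  non-isolated point \<open>p\<close>, and one isolated point for each pair of a set \<open>B\<close> in \<open>G\<close> and a point \<open>y\<close>
  of \<open>adh B\<close>; neighbourhoods of \<open>p\<close> contain the pairs with \<open>B \<subseteq> A\<close>, for some \<open>A\<close> in \<open>G\<close>. The map \<open>f\<close>
  sending \<open>(y, B)\<close> to \<open>y\<close> and \<open>p\<close> to \<open>y0\<close> carries the neighbourhood filter of \<open>p\<close> to a filter
  coarser than \<open>adh\<^sup>\<natural> G\<close>, so continuity of \<open>f\<close> makes \<open>adh\<^sup>\<natural> G\<close> converge to \<open>y0\<close>. On the other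
  hand \<open>f\<close> is always a continuous limit: choose at \<open>(y, B)\<close> an ultrafilter containing \<open>B\<close> and
  converging to \<open>y\<close>, and take the filter of boxes in \<open>Y\<^sup>X\<close> built from these ultrafilters. Its
  evaluation at \<open>(y, B)\<close> converges to \<open>y\<close>, while near \<open>p\<close> its values lie in \<open>A \<union> {y0}\<close>, for each
  \<open>A\<close> in \<open>G\<close>, because a box may be shrunk to take values in \<open>B\<close> at every \<open>(y, B)\<close> simultaneously.
  This is \<open>adh_filter_lim_if_fan_limits_continuous\<close>.

  The points of the fan have to be sets of elements of the type of \<open>Y\<close>. For infinite types the pairs
  \<open>(y, B)\<close> inject into these sets, since a point and a subset can be stored in two disjoint copies
  of the type inside itself. For a finite type there need not be room for all pairs, but then \<open>G\<close> has a
  least element, and the pairs whose \<open>B\<close> is that element suffice (\<open>filter_base_code\<close>).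
\<close>

section \<open>Proper filters and ultrafilters\<close>

lemma proper_filter_on_leI:
  "proper_filter_on X F \<Longrightarrow> G \<le> F \<Longrightarrow> G \<noteq> bot \<Longrightarrow> proper_filter_on X G"
  unfolding proper_filter_on_def by (meson order_trans)

lemma proper_filter_on_principal_point: "x \<in> X \<Longrightarrow> proper_filter_on X (principal {x})"
  by (auto simp: proper_filter_on_def principal_eq_bot_iff)

text \<open>
  Zorn's lemma for the reversed order: the infimum of a chain of proper filters is proper because
  a chain is directed, so that a set belongs to the infimum only if it belongs to a member.
\<close>
lemma ultrafilter_refinement:
  assumes F: "proper_filter_on X F"
  obtains U where "ultrafilter_on X U" "U \<le> F"
proof -
  let ?A = "{G. G \<noteq> bot \<and> G \<le> F}"
  let ?r = "relation_of (\<lambda>G H. H \<le> G) ?A"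
  have po: "partial_order_on ?A ?r"
    by (rule partial_order_on_relation_ofI) auto
  have "\<exists>U\<in>?A. \<forall>G\<in>C. U \<le> G" if C: "C \<in> Chains ?r" for C
  proof (cases "C = {}")
    case True
    then show ?thesis using F by (auto simp: proper_filter_on_def)
  next
    case False
    have sub: "C \<subseteq> ?A" and lin: "\<And>G H. G \<in> C \<Longrightarrow> H \<in> C \<Longrightarrow> G \<le> H \<or> H \<le> G"
      using C by (auto simp: Chains_def relation_of_def)
    have "Inf C \<noteq> bot"
    proof
      assume "Inf C = bot"
      then have "eventually (\<lambda>_. False) (Inf C)" by simp
      then have "\<exists>G\<in>C. eventually (\<lambda>_. False) G"
        by (subst (asm) eventually_Inf_base[OF False])
          (use lin in \<open>metis inf.absorb1 inf.absorb2 order_refl\<close>, simp)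
      then show False using sub by (auto simp: eventually_False)
    qed
    moreover obtain G where "G \<in> C" using False by blast
    then have "Inf C \<le> F" using sub by (blast intro: Inf_lower2)
    ultimately show ?thesis by (auto intro: Inf_lower)
  qed
  with predicate_Zorn[OF po] obtain U where U: "U \<in> ?A" "\<forall>G\<in>?A. G \<le> U \<longrightarrow> G = U"
    by blast
  have "ultrafilter_on X U"
    unfolding ultrafilter_on_def
  proof (intro conjI allI impI)
    show "proper_filter_on X U" using U(1) F proper_filter_on_leI by blast
    fix G assume "proper_filter_on X G" "G \<le> U"
    then show "G = U" using U by (auto simp: proper_filter_on_def)
  qed
  with U(1) that show thesis by blast
qed

section \<open>Adherence\<close>

context convergence_space
begin

lemma adh_subset: "adh X limX A \<subseteq> X"
  unfolding adh_def ultrafilter_on_def using lim_subset by blast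

text \<open>
  Although adherence is defined by ultrafilters only, it absorbs the limits of all filters, since
  refining a filter to an ultrafilter keeps its limits.
\<close>
lemma lim_subset_adh:
  assumes F: "proper_filter_on X F" and A: "\<forall>\<^sub>F x in F. x \<in> A"
  shows "limX F \<subseteq> adh X limX A"
proof -
  obtain U where U: "ultrafilter_on X U" "U \<le> F" using ultrafilter_refinement[OF F] .
  then have "limX F \<subseteq> limX U" by (intro lim_mono F) (simp_all add: ultrafilter_on_def)
  then show ?thesis unfolding adh_def using U A filter_leD by blast
qed

lemma subset_adh: "A \<subseteq> X \<Longrightarrow> A \<subseteq> adh X limX A"
  using lim_subset_adh[OF proper_filter_on_principal_point] lim_point
  by (fastforce simp: eventually_principal)

lemma proper_adh_filter:
  assumes F: "proper_filter_on X F"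
  shows "proper_filter_on X (adh_filter X limX F)"
proof -
  have FX: "F \<le> principal X" using F by (simp add: proper_filter_on_def)
  have "\<not> (\<forall>\<^sub>F x in adh_filter X limX F. x \<in> {})"
  proof
    assume "\<forall>\<^sub>F x in adh_filter X limX F. x \<in> {}"
    then obtain A where "A \<subseteq> X" "\<forall>\<^sub>F x in F. x \<in> A" "adh X limX A = {}"
      unfolding eventually_adh_filter[OF FX] by auto
    with subset_adh[of A] F show False
      by (auto simp: proper_filter_on_def)
  qed
  moreover have "\<forall>\<^sub>F x in adh_filter X limX F. x \<in> X"
    unfolding eventually_adh_filter[OF FX] using FX adh_subset by (auto simp: le_principal)
  ultimately show ?thesis
    by (auto simp: proper_filter_on_def le_principal)
qed

end

section \<open>Limits of continuous convergence in a regular space are continuous\<close>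

lemma proper_eval_filter:
  assumes G: "proper_filter_on X G" and F: "proper_filter_on (X \<rightarrow>\<^sub>E Y) F"
  shows "proper_filter_on Y (eval_filter G F)"
proof -
  have "\<forall>\<^sub>F y in eval_filter G F. y \<in> Y"
    unfolding eventually_eval_filter
    using G F by (intro exI[of _ X] exI[of _ "X \<rightarrow>\<^sub>E Y"]) (auto simp: proper_filter_on_def le_principal)
  moreover have "eval_filter G F \<noteq> bot"
    using G F by (simp add: eval_filter_def filtermap_bot_iff prod_filter_eq_bot proper_filter_on_def)
  ultimately show ?thesis by (simp add: proper_filter_on_def le_principal)
qed

lemma eval_filter_mono: "G \<le> G' \<Longrightarrow> eval_filter G F \<le> eval_filter G' F"
  unfolding eval_filter_def by (intro filtermap_mono prod_filter_mono) auto

lemma proper_filtermap: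
  assumes G: "proper_filter_on X G" and f: "f \<in> X \<rightarrow>\<^sub>E Y"
  shows "proper_filter_on Y (filtermap f G)"
proof -
  have "\<forall>\<^sub>F x in G. f x \<in> Y"
    using G f by (auto simp: proper_filter_on_def le_principal elim!: eventually_mono)
  then show ?thesis
    using G by (simp add: proper_filter_on_def filtermap_bot_iff le_principal eventually_filtermap)
qed

text \<open>
  Each value \<open>f a\<close> with \<open>a \<in> A\<close> is a limit of \<open>\<langle>{a}, F\<rangle>\<close>, a filter containing \<open>\<langle>A, H\<rangle>\<close>; so \<open>f\<close>
  maps \<open>A\<close> into the adherence of \<open>\<langle>A, H\<rangle>\<close>.
\<close>
theorem continuous_convergence_lim_continuous:
  assumes X: "convergence_space X limX" and Y: "convergence_space Y limY"
    and reg: "regular_convergence Y limY"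
    and F: "proper_filter_on (X \<rightarrow>\<^sub>E Y) F"
    and f: "f \<in> continuous_convergence_lim X limX Y limY F"
  shows "f \<in> continuous_maps X limX Y limY"
proof -
  interpret X: convergence_space X limX by fact
  interpret Y: convergence_space Y limY by fact
  have fXY: "f \<in> X \<rightarrow>\<^sub>E Y"
    and lim: "\<And>G x. proper_filter_on X G \<Longrightarrow> x \<in> limX G \<Longrightarrow> f x \<in> limY (eval_filter G F)"
    using f by (auto simp: continuous_convergence_lim_def)
  have "f x \<in> limY (filtermap f G)" if G: "proper_filter_on X G" and x: "x \<in> limX G" for G x
  proof -
    have E: "proper_filter_on Y (eval_filter G F)" by (rule proper_eval_filter[OF G F])
    have fadh: "f a \<in> adh Y limY {h x |h x. h \<in> H \<and> x \<in> A}"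
      if "a \<in> X" "a \<in> A" "\<forall>\<^sub>F h in F. h \<in> H" for a A H
    proof -
      have pt: "proper_filter_on X (principal {a})"
        using \<open>a \<in> X\<close> by (rule proper_filter_on_principal_point)
      have "\<forall>\<^sub>F y in eval_filter (principal {a}) F. y \<in> {h x |h x. h \<in> H \<and> x \<in> A}"
        unfolding eventually_eval_filter
        using that by (intro exI[of _ "{a}"] exI[of _ H]) (auto simp: eventually_principal)
      from Y.lim_subset_adh[OF proper_eval_filter[OF pt F] this] show ?thesis
        using lim[OF pt X.lim_point[OF \<open>a \<in> X\<close>]] by blast
    qed
    have "filtermap f G \<le> adh_filter Y limY (eval_filter G F)"
      unfolding le_filter_def
    proof (intro allI impI)
      fix P assume "eventually P (adh_filter Y limY (eval_filter G F))"
      then obtain B where B: "\<forall>\<^sub>F y in eval_filter G F. y \<in> B" "adh Y limY B \<subseteq> Collect P"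
        using eventually_adh_filter[of "eval_filter G F" Y "Collect P" limY] E
        by (auto simp: proper_filter_on_def)
      then obtain A H where AH: "\<forall>\<^sub>F x in G. x \<in> A" "\<forall>\<^sub>F h in F. h \<in> H"
        "{h x |h x. h \<in> H \<and> x \<in> A} \<subseteq> B"
        unfolding eventually_eval_filter by blast
      have "\<forall>\<^sub>F x in G. x \<in> X" using G by (simp add: proper_filter_on_def le_principal)
      with AH(1) have "\<forall>\<^sub>F x in G. P (f x)"
      proof eventually_elim
        case (elim a)
        then show ?case
            using fadh[OF _ _ AH(2)] adh_mono[OF AH(3), of Y limY] B(2) by blast
      qed
      then show "eventually P (filtermap f G)" by (simp add: eventually_filtermap)
    qed
    then have "limY (adh_filter Y limY (eval_filter G F)) \<subseteq> limY (filtermap f G)"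
      by (intro Y.lim_mono Y.proper_adh_filter E proper_filtermap[OF G fXY])
    then show ?thesis
      using reg E lim[OF G x] by (auto simp: regular_convergence_def)
  qed
  then show ?thesis using fXY by (auto simp: continuous_maps_def)
qed

section \<open>Filters of boxes\<close>

text \<open>
  All coordinates may be restricted at once, as in the box topology and unlike in the product
  topology: the fan argument constrains the values at all isolated points simultaneously.
\<close>
definition box_filter :: "'x set \<Rightarrow> ('x \<Rightarrow> 'y filter) \<Rightarrow> ('x \<Rightarrow> 'y) filter" where
  "box_filter X w = (INF W\<in>{W. \<forall>x\<in>X. \<forall>\<^sub>F y in w x. y \<in> W x}. principal (Pi\<^sub>E X W))"

text \<open>Boxes are closed under finite intersections, so they form a base.\<close>
lemma eventually_box_filter:
  "eventually P (box_filter X w) \<longleftrightarrow>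
    (\<exists>W. (\<forall>x\<in>X. \<forall>\<^sub>F y in w x. y \<in> W x) \<and> (\<forall>h\<in>Pi\<^sub>E X W. P h))"
proof -
  let ?S = "{W. \<forall>x\<in>X. \<forall>\<^sub>F y in w x. y \<in> W x}"
  have "?S \<noteq> {}" by (auto intro!: exI[of _ "\<lambda>_. UNIV"])
  moreover have "\<exists>V\<in>?S. principal (Pi\<^sub>E X V) \<le> inf (principal (Pi\<^sub>E X W)) (principal (Pi\<^sub>E X W'))"
    if "W \<in> ?S" "W' \<in> ?S" for W W'
    using that by (intro bexI[of _ "\<lambda>x. W x \<inter> W' x"]) (auto simp: eventually_conj PiE_iff)
  ultimately show ?thesis
    unfolding box_filter_def by (subst eventually_INF_base) (auto simp: eventually_principal)
qed

text \<open>By the axiom of choice, a box with nonempty sides is nonempty.\<close>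
lemma proper_box_filter:
  assumes w: "\<And>x. x \<in> X \<Longrightarrow> proper_filter_on Y (w x)"
  shows "proper_filter_on (X \<rightarrow>\<^sub>E Y) (box_filter X w)"
proof -
  have "\<forall>\<^sub>F h in box_filter X w. h \<in> X \<rightarrow>\<^sub>E Y"
    unfolding eventually_box_filter
    using w by (intro exI[of _ "\<lambda>_. Y"]) (auto simp: proper_filter_on_def le_principal)
  moreover have "\<not> (\<forall>\<^sub>F h in box_filter X w. False)"
  proof
    assume "\<forall>\<^sub>F h in box_filter X w. False"
    then obtain W where W: "\<forall>x\<in>X. \<forall>\<^sub>F y in w x. y \<in> W x" "Pi\<^sub>E X W = {}"
      unfolding eventually_box_filter by blast
    then obtain x where "x \<in> X" "W x = {}" by (auto simp: PiE_eq_empty_iff)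
    with W(1) w[of x] show False by (auto simp: proper_filter_on_def)
  qed
  ultimately show ?thesis by (auto simp: proper_filter_on_def le_principal)
qed

lemma eval_box_filter_le:
  assumes "x \<in> X"
  shows "eval_filter (principal {x}) (box_filter X w) \<le> w x"
  unfolding le_filter_def
proof (intro allI impI)
  fix P assume P: "eventually P (w x)"
  let ?H = "{h. P (h x)}"
  have "\<forall>\<^sub>F h in box_filter X w. h \<in> ?H"
    unfolding eventually_box_filter
    using assms P by (intro exI[of _ "\<lambda>z. if z = x then Collect P else UNIV"]) (auto simp: PiE_iff split: if_splits)
  then have "\<forall>\<^sub>F y in eval_filter (principal {x}) (box_filter X w). y \<in> Collect P"
    unfolding eventually_eval_filter
    by (intro exI[of _ "{x}"] exI[of _ ?H]) (auto simp: eventually_principal)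
  then show "eventually P (eval_filter (principal {x}) (box_filter X w))" by simp
qed

section \<open>The fan of a filter\<close>

text \<open>
  The points of \<open>I\<close> are isolated, and they tend to \<open>p\<close> as their labels \<open>s x\<close> shrink along \<open>G\<close>.
\<close>
definition fan_topology :: "'x \<Rightarrow> 'x set \<Rightarrow> ('x \<Rightarrow> 'y set) \<Rightarrow> 'y filter \<Rightarrow> 'x topology" where
  "fan_topology p I s G = topology (\<lambda>U. U \<subseteq> insert p I \<and>
     (p \<in> U \<longrightarrow> (\<exists>A. (\<forall>\<^sub>F y in G. y \<in> A) \<and> {x\<in>I. s x \<subseteq> A} \<subseteq> U)))"

lemma openin_fan_topology:
  "openin (fan_topology p I s G) U \<longleftrightarrow> U \<subseteq> insert p I \<and>
     (p \<in> U \<longrightarrow> (\<exists>A. (\<forall>\<^sub>F y in G. y \<in> A) \<and> {x\<in>I. s x \<subseteq> A} \<subseteq> U))"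
proof -
  have "istopology (\<lambda>U. U \<subseteq> insert p I \<and>
     (p \<in> U \<longrightarrow> (\<exists>A. (\<forall>\<^sub>F y in G. y \<in> A) \<and> {x\<in>I. s x \<subseteq> A} \<subseteq> U)))" (is "istopology ?O")
    unfolding istopology_def
  proof (intro conjI allI impI)
    fix S T assume ST: "?O S" "?O T"
    show "S \<inter> T \<subseteq> insert p I" using ST by blast
    assume "p \<in> S \<inter> T"
    with ST obtain A B where "\<forall>\<^sub>F y in G. y \<in> A" "{x\<in>I. s x \<subseteq> A} \<subseteq> S"
      "\<forall>\<^sub>F y in G. y \<in> B" "{x\<in>I. s x \<subseteq> B} \<subseteq> T" by blast
    then show "\<exists>A. (\<forall>\<^sub>F y in G. y \<in> A) \<and> {x\<in>I. s x \<subseteq> A} \<subseteq> S \<inter> T"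
      by (intro exI[of _ "A \<inter> B"]) (auto simp: eventually_conj)
  next
    fix K assume K: "\<forall>S\<in>K. ?O S"
    show "\<Union>K \<subseteq> insert p I" using K by blast
    assume "p \<in> \<Union>K"
    with K show "\<exists>A. (\<forall>\<^sub>F y in G. y \<in> A) \<and> {x\<in>I. s x \<subseteq> A} \<subseteq> \<Union>K" by (meson Union_iff Union_upper subset_trans)
  qed
  then show ?thesis by (simp add: fan_topology_def)
qed

lemma topspace_fan_topology [simp]: "topspace (fan_topology p I s G) = insert p I"
proof -
  have "openin (fan_topology p I s G) (insert p I)"
    by (auto simp: openin_fan_topology intro!: exI[of _ UNIV])
  moreover have "topspace (fan_topology p I s G) \<subseteq> insert p I"
    using openin_fan_topology[of p I s G "topspace (fan_topology p I s G)"] by simp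
  ultimately show ?thesis using openin_subset by blast
qed

lemma nhdsin_fan_topology_isolated:
  assumes "x \<in> I" "x \<noteq> p"
  shows "nhdsin (fan_topology p I s G) x \<le> principal {x}"
  using assms by (auto simp: le_principal eventually_nhdsin openin_fan_topology)

lemma eventually_nhdsin_fan_topology:
  "eventually P (nhdsin (fan_topology p I s G) p) \<longleftrightarrow>
    P p \<and> (\<exists>A. (\<forall>\<^sub>F y in G. y \<in> A) \<and> (\<forall>x\<in>I. s x \<subseteq> A \<longrightarrow> P x))"
proof
  assume "eventually P (nhdsin (fan_topology p I s G) p)"
  then show "P p \<and> (\<exists>A. (\<forall>\<^sub>F y in G. y \<in> A) \<and> (\<forall>x\<in>I. s x \<subseteq> A \<longrightarrow> P x))"
    by (fastforce simp: eventually_nhdsin openin_fan_topology)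
next
  assume "P p \<and> (\<exists>A. (\<forall>\<^sub>F y in G. y \<in> A) \<and> (\<forall>x\<in>I. s x \<subseteq> A \<longrightarrow> P x))"
  then obtain A where A: "P p" "\<forall>\<^sub>F y in G. y \<in> A" "\<forall>x\<in>I. s x \<subseteq> A \<longrightarrow> P x" by blast
  then have "openin (fan_topology p I s G) (insert p {x\<in>I. s x \<subseteq> A})"
    by (auto simp: openin_fan_topology)
  with A show "eventually P (nhdsin (fan_topology p I s G) p)"
    by (auto simp: eventually_nhdsin intro!: exI[of _ "insert p {x\<in>I. s x \<subseteq> A}"])
qed

text \<open>
  With \<open>I\<close> consisting of the pairs \<open>(y, B)\<close>, \<open>v\<close> and \<open>s\<close> are the projections and \<open>w\<close> is a
  choice of ultrafilters witnessing \<open>y \<in> adh B\<close>. The set \<open>I\<close> is left abstract so that the pairs can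
  be coded in any type with enough room; \<open>cover\<close> says that enough of them are present for the
  image of each neighbourhood of \<open>p\<close> to contain the adherence of a set of \<open>G\<close>.

  The box filter of \<open>w\<close>, extended by the principal filter of \<open>y0\<close> at \<open>p\<close>, converges continuously to
  the map \<open>v\<close> extended by \<open>y0\<close>. At the point \<open>p\<close> it gives a filter finer than the intersection of \<open>G\<close>
  and the principal filter of \<open>y0\<close>, which converges to \<open>y0\<close> by the intersection axiom.
\<close>
lemma adh_filter_lim_if_fan_limits_continuous:
  fixes p :: 'x and s :: "'x \<Rightarrow> 'y set"
  assumes Y: "convergence_space Y limY"
    and G: "proper_filter_on Y G" and y0: "y0 \<in> limY G"
    and pI: "p \<notin> I"
    and w: "\<And>x. x \<in> I \<Longrightarrow> proper_filter_on Y (w x)"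
    and ws: "\<And>x. x \<in> I \<Longrightarrow> \<forall>\<^sub>F y in w x. y \<in> s x"
    and wv: "\<And>x. x \<in> I \<Longrightarrow> v x \<in> limY (w x)"
    and cover: "\<And>A. \<forall>\<^sub>F y in G. y \<in> A \<Longrightarrow>
      \<exists>B. (\<forall>\<^sub>F y in G. y \<in> B) \<and> adh Y limY B \<subseteq> v ` {x\<in>I. s x \<subseteq> A}"
    and cont: "\<And>f F. f \<in> insert p I \<rightarrow>\<^sub>E Y \<Longrightarrow> proper_filter_on (insert p I \<rightarrow>\<^sub>E Y) F \<Longrightarrow>
      f \<in> continuous_convergence_lim (insert p I) (topological_lim (fan_topology p I s G)) Y limY F \<Longrightarrow>
      f \<in> continuous_maps (insert p I) (topological_lim (fan_topology p I s G)) Y limY"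
  shows "y0 \<in> limY (adh_filter Y limY G)"
proof -
  interpret Y: convergence_space Y limY by fact
  define T where "T = fan_topology p I s G"
  define X where "X = insert p I"
  define w' where "w' = w(p := principal {y0})"
  define f where "f = restrict (v(p := y0)) X"
  define F where "F = box_filter X w'"
  have y0Y: "y0 \<in> Y" using Y.lim_subset[OF G] y0 by blast
  have pt: "proper_filter_on Y (principal {y0})"
    by (rule proper_filter_on_principal_point[OF y0Y])
  have w'Y: "proper_filter_on Y (w' x)" and fw': "f x \<in> limY (w' x)" if "x \<in> X" for x
    using that w wv pI pt Y.lim_point[OF y0Y] by (auto simp: w'_def X_def f_def)
  have "f \<in> extensional X" by (simp add: f_def)
  then have fXY: "f \<in> X \<rightarrow>\<^sub>E Y"
    unfolding PiE_iff using fw' Y.lim_subset[OF w'Y] by blast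
  have F: "proper_filter_on (X \<rightarrow>\<^sub>E Y) F"
    unfolding F_def by (rule proper_box_filter[OF w'Y])
  have at_p: "eval_filter (nhdsin T p) F \<le> sup G (principal {y0})"
    unfolding le_filter_def
  proof (intro allI impI)
    fix P assume "eventually P (sup G (principal {y0}))"
    then have P: "\<forall>\<^sub>F y in G. y \<in> Collect P" "P y0"
      by (auto simp: eventually_sup eventually_principal)
    \<comment> \<open>The box with sides \<open>s x\<close> works for every \<open>P\<close>: only the neighbourhood of \<open>p\<close> depends on it.\<close>
    let ?N = "insert p {x\<in>I. s x \<subseteq> Collect P}"
    let ?H = "Pi\<^sub>E X (s(p := {y0}))"
    have "\<forall>\<^sub>F x in nhdsin T p. x \<in> ?N"
      unfolding T_def eventually_nhdsin_fan_topology using P(1) by blast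
    moreover have "\<forall>\<^sub>F h in F. h \<in> ?H"
      unfolding F_def eventually_box_filter
      using ws by (intro exI[of _ "s(p := {y0})"]) (auto simp: w'_def X_def eventually_principal)
    moreover have "{h x |h x. h \<in> ?H \<and> x \<in> ?N} \<subseteq> Collect P"
    proof clarify
      fix h x assume "h \<in> ?H" "x \<in> ?N"
      moreover have "x \<in> X" using \<open>x \<in> ?N\<close> by (auto simp: X_def)
      ultimately have "h x \<in> (s(p := {y0})) x" by (blast intro: PiE_mem)
      then show "P (h x)" using \<open>x \<in> ?N\<close> P(2) by (auto split: if_splits)
    qed
    ultimately have "\<forall>\<^sub>F y in eval_filter (nhdsin T p) F. y \<in> Collect P"
      unfolding eventually_eval_filter by blast
    then show "eventually P (eval_filter (nhdsin T p) F)" by simp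
  qed
  have "f x \<in> limY (eval_filter K F)"
    if K: "proper_filter_on X K" and x: "x \<in> topological_lim T K" for K x
  proof -
    have xX: "x \<in> X" and Kx: "K \<le> nhdsin T x"
      using x by (auto simp: topological_lim_def T_def X_def)
    have E: "proper_filter_on Y (eval_filter K F)" by (rule proper_eval_filter[OF K F])
    show ?thesis
    proof (cases "x = p")
      case True
      have S: "proper_filter_on Y (sup G (principal {y0}))"
        using G pt by (auto simp: proper_filter_on_def)
      have "eval_filter K F \<le> sup G (principal {y0})"
        using eval_filter_mono[OF Kx, of F] at_p True by auto
      then have "limY (sup G (principal {y0})) \<subseteq> limY (eval_filter K F)"
        by (rule Y.lim_mono[OF S E])
      moreover have "y0 \<in> limY (sup G (principal {y0}))"
        using Y.lim_sup[OF G pt] Y.lim_point[OF y0Y] y0 by blast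
      ultimately show ?thesis using True by (auto simp: f_def X_def)
    next
      case False
      then have "K \<le> principal {x}"
        using Kx nhdsin_fan_topology_isolated[of x I p s G] xX unfolding T_def X_def by auto
      then have "eval_filter K F \<le> w' x"
        unfolding F_def using eval_filter_mono eval_box_filter_le[OF xX] order_trans by blast
      then show ?thesis using Y.lim_mono[OF w'Y[OF xX] E] fw'[OF xX] by blast
    qed
  qed
  then have "f \<in> continuous_convergence_lim X (topological_lim T) Y limY F"
    using fXY by (simp add: continuous_convergence_lim_def)
  then have fcont: "f \<in> continuous_maps X (topological_lim T) Y limY"
    using cont fXY F by (simp add: X_def T_def)
  have N: "proper_filter_on X (nhdsin T p)"
  proof -
    have "\<forall>\<^sub>F x in nhdsin T p. x \<in> X" "\<not> (\<forall>\<^sub>F x in nhdsin T p. False)"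
      unfolding T_def X_def eventually_nhdsin_fan_topology by (auto intro!: exI[of _ UNIV])
    then show ?thesis by (auto simp: proper_filter_on_def le_principal)
  qed
  have "p \<in> topological_lim T (nhdsin T p)" by (simp add: topological_lim_def T_def)
  then have "f p \<in> limY (filtermap f (nhdsin T p))"
    using fcont N by (auto simp: continuous_maps_def)
  moreover have "adh_filter Y limY G \<le> filtermap f (nhdsin T p)"
    unfolding le_filter_def eventually_filtermap
  proof (intro allI impI)
    fix P assume "\<forall>\<^sub>F x in nhdsin T p. P (f x)"
    then obtain A where "\<forall>\<^sub>F y in G. y \<in> A" and A: "\<forall>x\<in>I. s x \<subseteq> A \<longrightarrow> P (f x)"
      unfolding T_def eventually_nhdsin_fan_topology by blast
    from cover[OF this(1)] obtain B
      where B: "\<forall>\<^sub>F y in G. y \<in> B" "adh Y limY B \<subseteq> v ` {x\<in>I. s x \<subseteq> A}" by blast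
    have GY: "\<forall>\<^sub>F y in G. y \<in> Y" using G by (simp add: proper_filter_on_def le_principal)
    have "v ` {x\<in>I. s x \<subseteq> A} \<subseteq> Collect P"
    proof clarify
      fix x assume "x \<in> I" "s x \<subseteq> A"
      moreover from this have "f x = v x" using pI by (auto simp: f_def X_def)
      ultimately show "P (v x)" using A by metis
    qed
    then have "adh Y limY (B \<inter> Y) \<subseteq> Collect P"
      using B(2) adh_mono[of "B \<inter> Y" B Y limY] by blast
    then have "\<forall>\<^sub>F y in adh_filter Y limY G. y \<in> Collect P"
      using B(1) GY G unfolding eventually_adh_filter[OF GY[folded le_principal]]
      by (intro exI[of _ "B \<inter> Y"]) (auto simp: eventually_conj)
    then show "eventually P (adh_filter Y limY G)" by simp
  qed
  then have "limY (filtermap f (nhdsin T p)) \<subseteq> limY (adh_filter Y limY G)"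
    by (intro Y.lim_mono proper_filtermap[OF N fXY] Y.proper_adh_filter G)
  ultimately show ?thesis by (auto simp: f_def X_def)
qed

section \<open>Coding the fan in the subsets of the type\<close>

text \<open>
  An infinite type contains two disjoint copies of itself; a pair \<open>(y, A)\<close> is stored as the point
  \<open>y\<close> in the first copy together with the set \<open>A\<close> in the second. The empty set is no code, and so
  can serve as the non-isolated point of the fan.
\<close>
lemma infinite_pairs_into_nonempty_sets:
  assumes "infinite (UNIV :: 'y set)"
  obtains e :: "'y \<times> 'y set \<Rightarrow> 'y set" where "inj e" "{} \<notin> range e"
proof -
  include cardinal_syntax
  have "|(UNIV :: 'y set) <+> (UNIV :: 'y set)| \<le>o |UNIV :: 'y set|"
    by (rule ordIso_imp_ordLeq[OF card_of_Plus_infinite1[OF assms]]) (rule card_of_mono1, simp)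
  then obtain j :: "'y + 'y \<Rightarrow> 'y" where j: "inj j"
    unfolding UNIV_Plus_UNIV card_of_ordLeq[symmetric] by blast
  define e :: "'y \<times> 'y set \<Rightarrow> 'y set" where "e = (\<lambda>(y, A). j ` (insert (Inl y) (Inr ` A)))"
  have "inj e"
  proof (rule injI)
    fix a b assume "e a = e b"
    then have "insert (Inl (fst a)) (Inr ` snd a) = insert (Inl (fst b)) (Inr ` snd b)"
      by (simp add: e_def split_beta inj_image_eq_iff[OF j] del: image_insert)
    then have "fst a = fst b" "snd a = snd b" by auto
    then show "a = b" by (rule prod_eqI)
  qed
  moreover have "{} \<notin> range e" by (auto simp: e_def)
  ultimately show thesis by (rule that)
qed

text \<open>
  Over a type with \<open>n\<close> elements there are \<open>n * 2 ^ n\<close> pairs but only \<open>2 ^ n\<close> codes, which is why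
  the sets must be restricted to a base. The intersection of all sets of the filter is then a base
  by itself, and singletons code the pairs.
\<close>
lemma filter_base_code:
  fixes G :: "'y filter"
  obtains \<B> :: "'y set set" and e :: "'y \<times> 'y set \<Rightarrow> 'y set"
  where "\<forall>A. (\<forall>\<^sub>F y in G. y \<in> A) \<longrightarrow> (\<exists>B\<in>\<B>. B \<subseteq> A \<and> (\<forall>\<^sub>F y in G. y \<in> B))"
    and "inj_on e (UNIV \<times> \<B>)" and "{} \<notin> e ` (UNIV \<times> \<B>)"
proof (cases "finite (UNIV :: 'y set)")
  case True
  let ?M = "\<Inter>{A. \<forall>\<^sub>F y in G. y \<in> A}"
  have "finite {A. \<forall>\<^sub>F y in G. y \<in> A}"
    using True by (simp add: Finite_Set.finite_set finite_subset[OF subset_UNIV])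
  then have "\<forall>\<^sub>F y in G. \<forall>A\<in>{A. \<forall>\<^sub>F y in G. y \<in> A}. y \<in> A"
    by (rule eventually_ball_finite) simp
  then have "\<forall>\<^sub>F y in G. y \<in> ?M" by simp
  then show thesis
    by (intro that[of "{?M}" "\<lambda>(y, _). {y}"]) (auto simp: inj_on_def)
next
  case False
  then obtain e :: "'y \<times> 'y set \<Rightarrow> 'y set" where e: "inj e" "{} \<notin> range e"
    by (rule infinite_pairs_into_nonempty_sets)
  then show thesis
    by (intro that[of UNIV e]) auto
qed

text \<open>
  Pairs over a base of the filter are enough for the fan: each set \<open>A\<close> of the filter contains a \<open>B\<close>
  of the base, and the pairs over \<open>B\<close>, which lie in the neighbourhood of the vertex given by \<open>A\<close>,
  already cover \<open>adh B\<close>.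
\<close>
theorem regular_if_topological_limits_continuous:
  fixes Y :: "'y set"
  assumes Y: "convergence_space Y limY"
    and cont: "\<And>(T :: 'y set topology) f F. f \<in> topspace T \<rightarrow>\<^sub>E Y \<Longrightarrow>
      proper_filter_on (topspace T \<rightarrow>\<^sub>E Y) F \<Longrightarrow>
      f \<in> continuous_convergence_lim (topspace T) (topological_lim T) Y limY F \<Longrightarrow>
      f \<in> continuous_maps (topspace T) (topological_lim T) Y limY"
  shows "regular_convergence Y limY"
  unfolding regular_convergence_def
proof (intro allI impI subsetI)
  fix G y0 assume G: "proper_filter_on Y G" and y0: "y0 \<in> limY G"
  obtain \<B> and e :: "'y \<times> 'y set \<Rightarrow> 'y set"
    where base: "\<forall>A. (\<forall>\<^sub>F y in G. y \<in> A) \<longrightarrow> (\<exists>B\<in>\<B>. B \<subseteq> A \<and> (\<forall>\<^sub>F y in G. y \<in> B))"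
      and inj: "inj_on e (UNIV \<times> \<B>)" and nonempty: "{} \<notin> e ` (UNIV \<times> \<B>)"
    by (rule filter_base_code[of G])
  define J where "J = (SIGMA B:{B\<in>\<B>. \<forall>\<^sub>F y in G. y \<in> B}. adh Y limY B)"
  define I where "I = (\<lambda>(B, y). e (y, B)) ` J"
  define d where "d = inv_into (UNIV \<times> \<B>) e"
  have d: "d (e (y, B)) = (y, B)" if "B \<in> \<B>" for y B
    using inj that by (simp add: d_def)
  have "\<exists>U. ultrafilter_on Y U \<and> (\<forall>\<^sub>F z in U. z \<in> B) \<and> y \<in> limY U" if "(B, y) \<in> J" for B y
    using that by (auto simp: J_def adh_def)
  then obtain u where u: "\<And>B y. (B, y) \<in> J \<Longrightarrow>
      ultrafilter_on Y (u B y) \<and> (\<forall>\<^sub>F z in u B y. z \<in> B) \<and> y \<in> limY (u B y)"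
    by metis
  have I: "snd (d x) \<in> \<B> \<and> (snd (d x), fst (d x)) \<in> J" if "x \<in> I" for x
    using that d by (auto simp: I_def J_def)
  show "y0 \<in> limY (adh_filter Y limY G)"
  proof (rule adh_filter_lim_if_fan_limits_continuous[OF Y G y0, where p = "{}" and I = I and s = "snd \<circ> d"
        and v = "fst \<circ> d" and w = "\<lambda>x. u (snd (d x)) (fst (d x))"])
    show "{} \<notin> I" using nonempty by (auto simp: I_def J_def)
    show "\<exists>B. (\<forall>\<^sub>F y in G. y \<in> B) \<and> adh Y limY B \<subseteq> (fst \<circ> d) ` {x\<in>I. (snd \<circ> d) x \<subseteq> A}"
      if A: "\<forall>\<^sub>F y in G. y \<in> A" for A
    proof -
      obtain B where B: "B \<in> \<B>" "B \<subseteq> A" "\<forall>\<^sub>F y in G. y \<in> B" using base A by blast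
      have "y \<in> (fst \<circ> d) ` {x\<in>I. (snd \<circ> d) x \<subseteq> A}" if "y \<in> adh Y limY B" for y
        using that B d[of B y] by (intro image_eqI[of _ _ "e (y, B)"]) (auto simp: I_def J_def)
      then show ?thesis using B(3) by blast
    qed
    fix x assume "x \<in> I"
    then show "proper_filter_on Y (u (snd (d x)) (fst (d x)))"
      and "\<forall>\<^sub>F y in u (snd (d x)) (fst (d x)). y \<in> (snd \<circ> d) x"
      and "(fst \<circ> d) x \<in> limY (u (snd (d x)) (fst (d x)))"
      using u[of "snd (d x)" "fst (d x)"] I[of x] by (simp_all add: ultrafilter_on_def)
  qed (rule cont[of _ "fan_topology {} I (snd \<circ> d) G", simplified topspace_fan_topology]; assumption)
qed

theorem corollary3:
  fixes Y :: "'y set" and limY :: "'y filter \<Rightarrow> 'y set"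
  assumes "convergence_space Y limY"
  shows
    "(regular_convergence Y limY \<longleftrightarrow>
        (\<forall>(X :: 'y set set) limX. convergence_space X limX \<longrightarrow>
          (\<forall>f \<in> X \<rightarrow>\<^sub>E Y. \<forall>F. proper_filter_on (X \<rightarrow>\<^sub>E Y) F \<longrightarrow>
            f \<in> continuous_convergence_lim X limX Y limY F \<longrightarrow>
            f \<in> continuous_maps X limX Y limY))) \<and>
     (regular_convergence Y limY \<longleftrightarrow>
        (\<forall>T :: 'y set topology.
          (\<forall>f \<in> topspace T \<rightarrow>\<^sub>E Y. \<forall>F. proper_filter_on (topspace T \<rightarrow>\<^sub>E Y) F \<longrightarrow>
            f \<in> continuous_convergence_lim (topspace T) (topological_lim T) Y limY F \<longrightarrow>
            f \<in> continuous_maps (topspace T) (topological_lim T) Y limY))) \<and>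
     (regular_convergence Y limY \<longrightarrow>
        (\<forall>(X :: 'x set) limX. convergence_space X limX \<longrightarrow>
          (\<forall>f \<in> X \<rightarrow>\<^sub>E Y. \<forall>F. proper_filter_on (X \<rightarrow>\<^sub>E Y) F \<longrightarrow>
            f \<in> continuous_convergence_lim X limX Y limY F \<longrightarrow>
            f \<in> continuous_maps X limX Y limY)) \<and>
        (\<forall>T :: 'x topology.
          (\<forall>f \<in> topspace T \<rightarrow>\<^sub>E Y. \<forall>F. proper_filter_on (topspace T \<rightarrow>\<^sub>E Y) F \<longrightarrow>
            f \<in> continuous_convergence_lim (topspace T) (topological_lim T) Y limY F \<longrightarrow>
            f \<in> continuous_maps (topspace T) (topological_lim T) Y limY)))"
proof -
  note limits_continuous = continuous_convergence_lim_continuous[OF _ assms]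
  note topological_limits_continuous = limits_continuous[OF convergence_space_topological]
  note regular = regular_if_topological_limits_continuous[OF assms]
  show ?thesis
  proof (intro conjI iffI impI allI ballI, goal_cases)
    case 1
    then show ?case by (intro limits_continuous)
  next
    case 2
    show ?case
      by (rule regular) (rule 2[rule_format, OF convergence_space_topological]; assumption)
  next
    case 3
    then show ?case by (intro topological_limits_continuous)
  next
    case 4
    show ?case by (rule regular) (rule 4[rule_format]; assumption)
  next
    case 5
    then show ?case by (intro limits_continuous)
  next
    case 6
    then show ?case by (intro topological_limits_continuous)
  qed
qed

end
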